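(* Let $\mu>-1/2$. There are finite constants $a>0$, $b>0$ and $c\ge0$ such that for all $f\in\mathcal{B}^2_\mu$, $$a\,S_\mu(f)\le b\,E_\mu(f)+c\,\|f\|^2_{\mathcal{B}^2_\mu}.$$
   Context: Fix $\mu>-1/2$. For $x>0$ and $\alpha\in\mathbf{R}$, $K_\alpha(x)=\int_0^\infty e^{-x\cosh u}\cosh(\alpha u)\,du$ is the Macdonald function. On $\mathbf{C}$ define the finite measures $d\nu_{e,\mu}(z)=\nu_{e,\mu}(z)\,dx\,dy$ and $d\nu_{o,\mu}(z)=\nu_{o,\mu}(z)\,dx\,dy$ with densities, for $z\neq0$, $$\nu_{e,\mu}(z)=\frac{2^{\frac12-\mu}}{\pi\Gamma(\mu+\frac12)}K_{\mu-\frac12}(|z|^2)|z|^{2\mu+1},\qquad \nu_{o,\mu}(z)=\frac{2^{\frac12-\mu}}{\pi\Gamma(\mu+\frac12)}K_{\mu+\frac12}(|z|^2)|z|^{2\mu+1}.$$ For $f:\mathbf{C}\to\mathbf{C}$, $f_e(z)=(f(z)+f(-z))/2$ and $f_o(z)=(f(z)-f(-z))/2$ are its even and odd parts. $\mathcal{B}^2_\mu$ is the space of entire functions $f$ with $f_e\in L^2(\mathbf{C},\nu_{e,\mu})$ and $f_o\in L^2(\mathbf{C},\nu_{o,\mu})$, with norm $\|f\|^2_{\mathcal{B}^2_\mu}=\|f_e\|^2_{L^2(\nu_{e,\mu})}+\|f_o\|^2_{L^2(\nu_{o,\mu})}$. Entropy: for a finite measure space $(\Omega,\nu)$ and $f\in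 L^2(\Omega,\nu)$, $S_{L^2(\Omega,\nu)}(f)=\int_\Omega|f|^2\log|f|^2\,d\nu-\|f\|^2_{L^2}\log\|f\|^2_{L^2}\in(-\infty,+\infty]$, with $0\log0=0$. Let $\mathbf{Z}_2=\{-1,+1\}$ and let $\nu_\mu$ be the measure on $\mathbf{C}\times\mathbf{Z}_2$ equal to $\nu_{e,\mu}$ on $\mathbf{C}\times\{+1\}$ and to $\nu_{o,\mu}$ on $\mathbf{C}\times\{-1\}$. The $\mu$-deformed entropy of $f\in\mathcal{B}^2_\mu$ is $S_\mu(f)=S_{L^2(\mathbf{C}\times\mathbf{Z}_2,\nu_\mu)}(f_e,f_o)$, where $(f_e,f_o)$ denotes the function equal to $f_e$ on $\mathbf{C}\times\{+1\}$ and to $f_o$ on $\mathbf{C}\times\{-1\}$. $\mu$-deformed energy: $E_\mu(f)=\int_{\mathbf{C}}|z|^2|f_e(z)|^2\,d\nu_{e,\mu}(z)+\int_{\mathbf{C}}|z|^2|f_o(z)|^2\,d\nu_{o,\mu}(z)\in[0,+\infty]$. *)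

theory Defs
  imports "HOL-Analysis.Analysis"
begin

definition macdonald :: "real \<Rightarrow> real \<Rightarrow> real" where
  "macdonald \<alpha> x = (LINT u:{0..}|lborel. exp (- x * cosh u) * cosh (\<alpha> * u))"

text \<open>The value of the densities at \<open>z = 0\<close> is a junk value; it is irrelevant because
  a point is a Lebesgue null set.\<close>

definition dens_e :: "real \<Rightarrow> complex \<Rightarrow> real" where
  "dens_e \<mu> z = 2 powr (1/2 - \<mu>) / (pi * Gamma (\<mu> + 1/2))
     * macdonald (\<mu> - 1/2) ((cmod z)\<^sup>2) * cmod z powr (2 * \<mu> + 1)"

definition dens_o :: "real \<Rightarrow> complex \<Rightarrow> real" where
  "dens_o \<mu> z = 2 powr (1/2 - \<mu>) / (pi * Gamma (\<mu> + 1/2))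
     * macdonald (\<mu> + 1/2) ((cmod z)\<^sup>2) * cmod z powr (2 * \<mu> + 1)"

definition nu_e :: "real \<Rightarrow> complex measure" where
  "nu_e \<mu> = density lborel (\<lambda>z. ennreal (dens_e \<mu> z))"

definition nu_o :: "real \<Rightarrow> complex measure" where
  "nu_o \<mu> = density lborel (\<lambda>z. ennreal (dens_o \<mu> z))"

text \<open>The group \<open>Z\<^sub>2\<close> is the set \<open>{-1, 1}\<close> of integers. That \<open>nu \<mu>\<close> restricts to
  \<open>nu_e \<mu>\<close> and \<open>nu_o \<mu>\<close> on the two sheets is \<open>emeasure_nu\<close> below.\<close>

definition nu :: "real \<Rightarrow> (complex \<times> int) measure" where
  "nu \<mu> = density (lborel \<Otimes>\<^sub>M count_space {-1, 1})
     (\<lambda>(z, s). ennreal (if s = 1 then dens_e \<mu> z else dens_o \<mu> z))"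

definition even_part :: "(complex \<Rightarrow> complex) \<Rightarrow> complex \<Rightarrow> complex" where
  "even_part f z = (f z + f (- z)) / 2"

definition odd_part :: "(complex \<Rightarrow> complex) \<Rightarrow> complex \<Rightarrow> complex" where
  "odd_part f z = (f z - f (- z)) / 2"

definition in_L2 :: "'a measure \<Rightarrow> ('a \<Rightarrow> complex) \<Rightarrow> bool" where
  "in_L2 M f \<longleftrightarrow> f \<in> borel_measurable M \<and> integrable M (\<lambda>x. (cmod (f x))\<^sup>2)"

definition norm_L2 :: "'a measure \<Rightarrow> ('a \<Rightarrow> complex) \<Rightarrow> real" where
  "norm_L2 M f = sqrt (LINT x|M. (cmod (f x))\<^sup>2)"

definition B2 :: "real \<Rightarrow> (complex \<Rightarrow> complex) set" where
  "B2 \<mu> = {f. f holomorphic_on UNIV \<and> in_L2 (nu_e \<mu>) (even_part f) \<and> in_L2 (nu_o \<mu>) (odd_part f)}"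

definition norm_B2 :: "real \<Rightarrow> (complex \<Rightarrow> complex) \<Rightarrow> real" where
  "norm_B2 \<mu> f = sqrt ((norm_L2 (nu_e \<mu>) (even_part f))\<^sup>2 + (norm_L2 (nu_o \<mu>) (odd_part f))\<^sup>2)"

text \<open>Extended-real integral of a function whose negative part has finite integral. The integral
  of the positive part may be infinite, so the Bochner integral (which would then be \<open>0\<close>)
  cannot be used.\<close>

definition ext_integral :: "'a measure \<Rightarrow> ('a \<Rightarrow> real) \<Rightarrow> ereal" where
  "ext_integral M g =
     enn2ereal (\<integral>\<^sup>+ x. ennreal (g x) \<partial>M) - enn2ereal (\<integral>\<^sup>+ x. ennreal (- g x) \<partial>M)"

text \<open>For a finite measure the negative part of \<open>\<bar>f\<bar>\<^sup>2 log \<bar>f\<bar>\<^sup>2\<close> is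
  bounded by \<open>1/e\<close>, hence integrable. The convention \<open>0 log 0 = 0\<close> is automatic.\<close>

definition entropy_L2 :: "'a measure \<Rightarrow> ('a \<Rightarrow> complex) \<Rightarrow> ereal" where
  "entropy_L2 M f =
     ext_integral M (\<lambda>x. (cmod (f x))\<^sup>2 * ln ((cmod (f x))\<^sup>2))
     - ereal ((norm_L2 M f)\<^sup>2 * ln ((norm_L2 M f)\<^sup>2))"

definition entropy_mu :: "real \<Rightarrow> (complex \<Rightarrow> complex) \<Rightarrow> ereal" where
  "entropy_mu \<mu> f =
     entropy_L2 (nu \<mu>) (\<lambda>(z, s). if s = 1 then even_part f z else odd_part f z)"

definition energy_mu :: "real \<Rightarrow> (complex \<Rightarrow> complex) \<Rightarrow> ennreal" where
  "energy_mu \<mu> f =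
     (\<integral>\<^sup>+ z. ennreal ((cmod z)\<^sup>2 * (cmod (even_part f z))\<^sup>2) \<partial>nu_e \<mu>)
     + (\<integral>\<^sup>+ z. ennreal ((cmod z)\<^sup>2 * (cmod (odd_part f z))\<^sup>2) \<partial>nu_o \<mu>)"

lemma measurable_cosh [measurable]: "(cosh :: real \<Rightarrow> real) \<in> borel_measurable borel"
  by (intro borel_measurable_continuous_onI continuous_intros)

lemma measurable_macdonald [measurable]: "macdonald \<alpha> \<in> borel_measurable borel"
  unfolding macdonald_def set_lebesgue_integral_def by measurable

lemma measurable_dens [measurable]:
  "dens_e \<mu> \<in> borel_measurable borel" "dens_o \<mu> \<in> borel_measurable borel"
  unfolding dens_e_def dens_o_def by measurable

lemma emeasure_nu:
  assumes A [measurable]: "A \<in> sets borel"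
  shows "emeasure (nu \<mu>) (A \<times> {1}) = emeasure (nu_e \<mu>) A"
    and "emeasure (nu \<mu>) (A \<times> {-1}) = emeasure (nu_o \<mu>) A"
proof -
  interpret C: sigma_finite_measure "count_space {-1, 1::int}"
    by (rule sigma_finite_measure_count_space_finite) simp
  define d where "d = (\<lambda>(z, s::int). ennreal (if s = 1 then dens_e \<mu> z else dens_o \<mu> z))"
  have d [measurable]: "d \<in> borel_measurable (lborel \<Otimes>\<^sub>M count_space {-1, 1})"
    unfolding d_def by measurable
  have split: "emeasure (nu \<mu>) (A \<times> {t}) = (\<integral>\<^sup>+ z. d (z, t) * indicator A z \<partial>lborel)"
    if t: "t \<in> {-1, 1}" for t
  proof -
    have [measurable]: "A \<times> {t} \<in> sets (lborel \<Otimes>\<^sub>M count_space {-1, 1})"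
      using t by (intro pair_measureI) auto
    have "emeasure (nu \<mu>) (A \<times> {t})
        = (\<integral>\<^sup>+ p. d p * indicator (A \<times> {t}) p \<partial>(lborel \<Otimes>\<^sub>M count_space {-1, 1}))"
      unfolding nu_def d_def [symmetric] by (rule emeasure_density) measurable
    also have "\<dots> = (\<integral>\<^sup>+ z. \<integral>\<^sup>+ s. d (z, s) * indicator (A \<times> {t}) (z, s)
        \<partial>count_space {-1, 1} \<partial>lborel)"
      by (rule C.nn_integral_fst [symmetric]) measurable
    also have "\<dots> = (\<integral>\<^sup>+ z. d (z, t) * indicator A z \<partial>lborel)"
      using t by (intro nn_integral_cong) (auto simp: nn_integral_count_space_finite indicator_def)
    finally show ?thesis .
  qed
  show "emeasure (nu \<mu>) (A \<times> {1}) = emeasure (nu_e \<mu>) A"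
    by (simp add: split nu_e_def emeasure_density d_def)
  show "emeasure (nu \<mu>) (A \<times> {-1}) = emeasure (nu_o \<mu>) A"
    by (simp add: split nu_o_def emeasure_density d_def)
qed

end

theory Submission
  imports Defs "HOL-Complex_Analysis.Complex_Analysis"
begin

text \<open>Point evaluations on the Bargmann-type space satisfy a Gaussian bound
  \<open>h(z) \<le> K exp (4 |z|\<^sup>2) \<parallel>f\<parallel>\<^sup>2\<close>, where \<open>h\<close> is \<open>|f\<^sub>e|\<^sup>2\<close> or
  \<open>|f\<^sub>o|\<^sup>2\<close>: outside the unit disc both densities dominate a multiple of
  \<open>exp (- 2 |z|\<^sup>2)\<close>, so the area mean value inequality on unit discs gives the bound for
  \<open>|z| \<ge> 2\<close>, and the maximum principle extends it to the origin, near which a density may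
  vanish. Taking logarithms, \<open>h ln h \<le> h (ln K + 4 |z|\<^sup>2 + ln \<parallel>f\<parallel>\<^sup>2)\<close>, and integrating this
  against \<open>nu\<close> gives the inequality with \<open>a = 1\<close>, \<open>b = 4\<close>, \<open>c = |ln K|\<close>.\<close>

section \<open>Rotation invariance of Lebesgue measure on the complex plane\<close>

text \<open>Boxes determine Lebesgue measure, and \<open>Complex\<close> matches boxes with boxes of
  the same side lengths. Integrals over complex numbers can thus be computed on pairs of reals, one
  coordinate at a time.\<close>

lemma lborel_complex: "lborel = distr lborel borel (\<lambda>(x, y). Complex x y)"
proof (rule lborel_eqI)
  have [measurable]: "(\<lambda>(x, y). Complex x y) \<in> borel_measurable borel"
    by (intro borel_measurable_continuous_onI)
       (auto simp: Complex_eq case_prod_beta intro!: continuous_intros)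
  fix l u :: complex
  assume le: "\<And>b. b \<in> Basis \<Longrightarrow> l \<bullet> b \<le> u \<bullet> b"
  have vimage: "(\<lambda>(x, y). Complex x y) -` box l u = box (Re l, Im l) (Re u, Im u)"
    by (auto simp: box_def Basis_complex_def Basis_prod_def)
  have "Re l \<le> Re u" "Im l \<le> Im u"
    using le[of 1] le[of \<i>] by (auto simp: Basis_complex_def)
  then show "emeasure (distr lborel borel (\<lambda>(x, y). Complex x y)) (box l u)
      = (\<Prod>b\<in>Basis. (u - l) \<bullet> b)"
    by (subst emeasure_distr)
       (auto simp: vimage emeasure_lborel_box_eq Basis_complex_def Basis_prod_def)
qed simp

text \<open>With the other coordinate held fixed, a shear is a translation; Tonelli in the matching
  order reduces both claims to translation invariance on the line.\<close>

lemma nn_integral_shear: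
  fixes f :: "real \<times> real \<Rightarrow> ennreal"
  assumes [measurable]: "f \<in> borel_measurable borel"
  shows "(\<integral>\<^sup>+ p. f (fst p + a * snd p, snd p) \<partial>lborel) = (\<integral>\<^sup>+ p. f p \<partial>lborel)"
    and "(\<integral>\<^sup>+ p. f (fst p, snd p + a * fst p) \<partial>lborel) = (\<integral>\<^sup>+ p. f p \<partial>lborel)"
proof -
  have [measurable]: "f \<in> borel_measurable (borel \<Otimes>\<^sub>M borel)"
    by (simp add: borel_prod)
  have tr: "(\<integral>\<^sup>+ x. g (x + c) \<partial>lborel) = (\<integral>\<^sup>+ x. g x \<partial>lborel)"
    if "g \<in> borel_measurable borel" for g :: "real \<Rightarrow> ennreal" and c
    using nn_integral_real_affine[OF that, of 1 c] by (simp add: add.commute)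
  show "(\<integral>\<^sup>+ p. f (fst p + a * snd p, snd p) \<partial>lborel) = (\<integral>\<^sup>+ p. f p \<partial>lborel)"
    unfolding lborel_prod[symmetric]
    by (subst (1 2) lborel_pair.nn_integral_snd[symmetric])
       (simp_all add: tr[of "\<lambda>x. f (x, y)" for y])
  show "(\<integral>\<^sup>+ p. f (fst p, snd p + a * fst p) \<partial>lborel) = (\<integral>\<^sup>+ p. f p \<partial>lborel)"
    unfolding lborel_prod[symmetric]
    by (subst (1 2) lborel.nn_integral_fst[symmetric])
       (simp_all add: tr[of "\<lambda>y. f (x, y)" for x])
qed

text \<open>A rotation by an angle other than \<open>\<pi>\<close> is a product of three shears.\<close>

lemma nn_integral_rotate:
  fixes F :: "complex \<Rightarrow> ennreal"
  assumes F [measurable]: "F \<in> borel_measurable borel" and u: "cmod u = 1"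
  shows "(\<integral>\<^sup>+ w. F (w * u) \<partial>lborel) = (\<integral>\<^sup>+ w. F w \<partial>lborel)"
proof -
  have [measurable]: "(\<lambda>(x, y). Complex x y) \<in> borel_measurable borel"
    by (intro borel_measurable_continuous_onI)
       (auto simp: Complex_eq case_prod_beta intro!: continuous_intros)
  have plane: "(\<integral>\<^sup>+ w. G w \<partial>lborel) = (\<integral>\<^sup>+ p. G (Complex (fst p) (snd p)) \<partial>lborel)"
    if "G \<in> borel_measurable borel" for G :: "complex \<Rightarrow> ennreal"
    using that by (subst lborel_complex) (simp add: nn_integral_distr case_prod_beta)
  have rot: "(\<integral>\<^sup>+ w. G (w * v) \<partial>lborel) = (\<integral>\<^sup>+ w. G w \<partial>lborel)"
    if G [measurable]: "G \<in> borel_measurable borel" and v: "cmod v = 1" "v \<noteq> -1"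
    for G :: "complex \<Rightarrow> ennreal" and v
  proof -
    define c s where "c = Re v" and "s = Im v"
    have cs: "c\<^sup>2 + s\<^sup>2 = 1"
      using v(1) by (simp add: c_def s_def cmod_def)
    have "c \<noteq> -1"
    proof
      assume "c = -1"
      with cs have "s = 0" by simp
      with \<open>c = -1\<close> v(2) show False by (simp add: c_def s_def complex_eq_iff)
    qed
    \<comment> \<open>For \<open>v = cis t\<close> this is \<open>- tan (t / 2)\<close>, the
      parameter of both horizontal shears; the vertical one has parameter \<open>s\<close>. The pole
      at \<open>c = -1\<close> is what excludes the half turn.\<close>
    define a where "a = - s / (1 + c)"
    have ac: "a * (1 + c) = - s"
      using \<open>c \<noteq> -1\<close> by (simp add: a_def add_eq_0_iff)
    have "(1 + a * s) * (1 + c) = c * (1 + c)"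
      using ac cs by algebra
    then have as: "1 + a * s = c"
      using \<open>c \<noteq> -1\<close> by (simp add: add_eq_0_iff)
    define g where "g p = G (Complex (fst p) (snd p))" for p
    have g [measurable]: "g \<in> borel_measurable borel"
      unfolding g_def using measurable_compose[OF \<open>(\<lambda>(x, y). Complex x y) \<in> _\<close> G]
      by (simp add: case_prod_beta)
    \<comment> \<open>\<open>g3\<close> is \<open>g\<close> after all three shears, so the integral
      can shed them one at a time.\<close>
    define g1 where "g1 p = g (fst p + a * snd p, snd p)" for p
    define g2 where "g2 p = g1 (fst p, snd p + s * fst p)" for p
    define g3 where "g3 p = g2 (fst p + a * snd p, snd p)" for p
    have [measurable]: "g1 \<in> borel_measurable borel"
      unfolding g1_def by (rule measurable_compose[OF _ g])
        (auto intro!: borel_measurable_continuous_onI continuous_intros)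
    have [measurable]: "g2 \<in> borel_measurable borel"
      unfolding g2_def by (rule measurable_compose[of _ _ borel g1])
        (auto intro!: borel_measurable_continuous_onI continuous_intros)
    have "G (Complex (fst p) (snd p) * v) = g3 p" for p
    proof -
      define x y where "x = fst p" and "y = snd p"
      have "x + a * y + a * (y + s * (x + a * y)) = (1 + a * s) * x + (a * (1 + (1 + a * s))) * y"
        by (simp add: algebra_simps)
      then have "x + a * y + a * (y + s * (x + a * y)) = c * x - s * y"
        by (simp add: as ac)
      moreover have "y + s * (x + a * y) = s * x + (1 + a * s) * y"
        by (simp add: algebra_simps)
      then have "y + s * (x + a * y) = s * x + c * y"
        by (simp add: as)
      moreover have "Complex x y * v = Complex (c * x - s * y) (s * x + c * y)"
        by (simp add: c_def s_def complex_eq_iff algebra_simps)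
      ultimately show ?thesis
        by (simp add: g3_def g2_def g1_def g_def flip: x_def y_def)
    qed
    then have "(\<integral>\<^sup>+ w. G (w * v) \<partial>lborel) = (\<integral>\<^sup>+ p. g3 p \<partial>lborel)"
      by (subst plane) simp_all
    also have "\<dots> = (\<integral>\<^sup>+ p. g2 p \<partial>lborel)"
      unfolding g3_def by (rule nn_integral_shear) measurable
    also have "\<dots> = (\<integral>\<^sup>+ p. g1 p \<partial>lborel)"
      unfolding g2_def by (rule nn_integral_shear) measurable
    also have "\<dots> = (\<integral>\<^sup>+ p. g p \<partial>lborel)"
      unfolding g1_def by (rule nn_integral_shear) measurable
    also have "\<dots> = (\<integral>\<^sup>+ w. G w \<partial>lborel)"
      by (simp add: g_def plane)
    finally show ?thesis .
  qed
  show ?thesis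
  proof (cases "u = -1")
    case True
    \<comment> \<open>The half turn is two quarter turns, each covered by
      \<open>rot\<close>.\<close>
    have "(\<integral>\<^sup>+ w. F (w * \<i> * \<i>) \<partial>lborel) = (\<integral>\<^sup>+ w. F (w * \<i>) \<partial>lborel)"
      by (rule rot[of "\<lambda>w. F (w * \<i>)" \<i>]) (auto simp: complex_eq_iff)
    also have "\<dots> = (\<integral>\<^sup>+ w. F w \<partial>lborel)"
      by (rule rot) (auto simp: complex_eq_iff)
    finally show ?thesis
      using True by (simp add: mult.assoc)
  qed (rule rot[OF F u])
qed

section \<open>Mean value inequalities on circles and discs\<close>

text \<open>In Cauchy's formula at the centre, the velocity of the circle is
  \<open>2 * pi * \<i>\<close> times its position, so the denominator cancels and the plain average
  of \<open>h\<close> remains. Circles of radius \<open>|w|\<close> about \<open>z\<close> are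
  reached later by composing with the affine map \<open>v \<mapsto> z + w * v\<close>.\<close>

lemma circle_mean_le:
  assumes "h holomorphic_on UNIV"
  shows "ennreal (cmod (h 0))
    \<le> (\<integral>\<^sup>+ t. indicator {0..1} t * ennreal (cmod (h (cis (2 * pi * t)))) \<partial>lborel)"
proof -
  define H where "H t = h (cis (2 * pi * t))" for t
  have "continuous_on UNIV h"
    using assms by (rule holomorphic_on_imp_continuous_on)
  then have cont: "continuous_on {0..1} H"
    unfolding H_def by (auto intro!: continuous_intros continuous_on_compose2[of UNIV h] simp: cis_conv_exp)
  have int: "set_integrable lborel {0..1} H"
    by (rule borel_integrable_atLeastAtMost'[OF cont])
  have "((\<lambda>u. h u / (u - 0)) has_contour_integral (2 * of_real pi * \<i> * h 0)) (circlepath 0 1)"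
    by (rule Cauchy_integral_circlepath_simple) (use assms holomorphic_on_subset in auto)
  then have "((\<lambda>t. 2 * of_real pi * \<i> * H t) has_integral (2 * of_real pi * \<i> * h 0)) {0..1}"
    unfolding has_contour_integral_def
  proof (rule has_integral_eq[rotated])
    fix t :: real
    assume t: "t \<in> {0..1}"
    have "vector_derivative (circlepath 0 1) (at t within {0..1})
        = 2 * of_real pi * \<i> * circlepath 0 1 t"
      using t by (subst vector_derivative_circlepath01) (simp_all add: circlepath)
    moreover have "circlepath 0 1 t = cis (2 * pi * t)"
      by (simp add: circlepath cis_conv_exp mult_ac)
    ultimately show "h (circlepath 0 1 t) / (circlepath 0 1 t - 0)
        * vector_derivative (circlepath 0 1) (at t within {0..1}) = 2 * of_real pi * \<i> * H t"
      by (simp add: H_def)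
  qed
  from has_integral_mult_right[OF this, of "1 / (2 * of_real pi * \<i>)"]
  have "(H has_integral h 0) {0..1}" by simp
  then have "h 0 = (LINT t:{0..1}|lborel. H t)"
    using set_borel_integral_eq_integral(2)[OF int] by (simp add: integral_unique)
  then have "ennreal (cmod (h 0)) \<le> (\<integral>\<^sup>+ t. ennreal (cmod (indicator {0..1} t *\<^sub>R H t)) \<partial>lborel)"
    unfolding set_lebesgue_integral_def
    by (simp only:) (rule integral_norm_bound_ennreal[OF int[unfolded set_integrable_def]])
  also have "\<dots> = (\<integral>\<^sup>+ t. indicator {0..1} t * ennreal (cmod (H t)) \<partial>lborel)"
    by (intro nn_integral_cong) (auto simp: indicator_def)
  finally show ?thesis
    unfolding H_def .
qed

text \<open>Averaging the mean value property over the circles around \<open>z\<close>; rotation invariance of the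
  Lebesgue measure replaces polar coordinates.\<close>

lemma ball_submean:
  fixes g :: "complex \<Rightarrow> complex"
  assumes g: "g holomorphic_on UNIV"
  shows "ennreal (cmod (g z)) * emeasure lborel (ball (0::complex) 1)
    \<le> (\<integral>\<^sup>+ w. indicator (ball z 1) w * ennreal (cmod (g w)) \<partial>lborel)"
proof -
  have "continuous_on UNIV g"
    using g by (rule holomorphic_on_imp_continuous_on)
  then have [measurable]: "g \<in> borel_measurable borel"
    by (rule borel_measurable_continuous_onI)
  have [measurable]: "cis \<in> borel_measurable borel"
    by (intro borel_measurable_continuous_onI) (auto simp: cis_conv_exp intro!: continuous_intros)
  have [measurable]: "ball z r \<in> sets borel" for z :: complex and r by simp
  \<comment> \<open>The disc is moved to the origin, the fixed point of the rotations.\<close>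
  define F where "F w = indicator (ball 0 1) w * ennreal (cmod (g (z + w)))" for w
  have [measurable]: "F \<in> borel_measurable borel"
    unfolding F_def by measurable
  have "ennreal (cmod (g z)) * emeasure lborel (ball (0::complex) 1)
      = (\<integral>\<^sup>+ w. indicator (ball (0::complex) 1) w * ennreal (cmod (g z)) \<partial>lborel)"
    by (simp add: nn_integral_cmult_indicator mult.commute[of "indicator _ _"])
  also have "\<dots> \<le> (\<integral>\<^sup>+ w. \<integral>\<^sup>+ t. indicator {0..1} t * F (w * cis (2 * pi * t)) \<partial>lborel \<partial>lborel)"
  proof (rule nn_integral_mono)
    \<comment> \<open>The indicator depends only on \<open>|w|\<close>, so it may be evaluated at
      the rotated point and absorbed into \<open>F\<close>.\<close>
    fix w :: complex
    have "(\<lambda>v. g (z + w * v)) holomorphic_on UNIV"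
      by (rule holomorphic_on_compose[OF _ holomorphic_on_subset[OF g], unfolded o_def])
         (auto intro!: holomorphic_intros)
    from circle_mean_le[OF this]
    have "indicator (ball 0 1) w * ennreal (cmod (g z)) \<le> indicator (ball 0 1) w *
      (\<integral>\<^sup>+ t. indicator {0..1} t * ennreal (cmod (g (z + w * cis (2 * pi * t)))) \<partial>lborel)"
      by (intro mult_left_mono) auto
    also have "\<dots> = (\<integral>\<^sup>+ t. indicator {0..1} t * F (w * cis (2 * pi * t)) \<partial>lborel)"
      by (subst nn_integral_cmult[symmetric], measurable)
         (auto intro!: nn_integral_cong simp: F_def indicator_def norm_mult)
    finally show "indicator (ball 0 1) w * ennreal (cmod (g z))
      \<le> (\<integral>\<^sup>+ t. indicator {0..1} t * F (w * cis (2 * pi * t)) \<partial>lborel)" .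
  qed
  also have "\<dots> = (\<integral>\<^sup>+ t. \<integral>\<^sup>+ w. indicator {0..1} t * F (w * cis (2 * pi * t)) \<partial>lborel \<partial>lborel)"
    by (rule lborel_pair.Fubini'[symmetric]) measurable
  \<comment> \<open>After the exchange, rotation invariance makes the inner integral independent of
    \<open>t\<close>, and \<open>{0..1}\<close> has measure one.\<close>
  also have "\<dots> = (\<integral>\<^sup>+ t. indicator {0..1::real} t * (\<integral>\<^sup>+ w. F w \<partial>lborel) \<partial>lborel)"
    by (simp add: nn_integral_cmult nn_integral_rotate)
  also have "\<dots> = (\<integral>\<^sup>+ w. F w \<partial>lborel)"
    by (simp add: nn_integral_multc)
  also have "\<dots> = (\<integral>\<^sup>+ w. indicator (ball z 1) (z + w) * ennreal (cmod (g (z + w))) \<partial>lborel)"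
    by (intro nn_integral_cong) (auto simp: F_def indicator_def dist_norm)
  also have "\<dots> = (\<integral>\<^sup>+ w. indicator (ball z 1) w * ennreal (cmod (g w)) \<partial>distr lborel borel ((+) z))"
    by (subst nn_integral_distr) auto
  also have "\<dots> = (\<integral>\<^sup>+ w. indicator (ball z 1) w * ennreal (cmod (g w)) \<partial>lborel)"
    by (simp add: lborel_distr_plus)
  finally show ?thesis .
qed

section \<open>Lower bounds for the Macdonald function and the densities\<close>

text \<open>The Bochner integral of a non-integrable function is 0 by default, so a positive lower
  bound for \<open>macdonald\<close> rests on this. It holds because \<open>x * cosh u\<close>
  outgrows every linear function of \<open>u\<close>.\<close>

lemma macdonald_integrable:
  fixes x \<alpha> :: real
  assumes x: "x > 0"
  shows "set_integrable lborel {0..} (\<lambda>u. exp (- x * cosh u) * cosh (\<alpha> * u))"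
proof -
  \<comment> \<open>The exponent is the maximum over \<open>u\<close> of
    \<open>(|\<alpha>| + 1) * u - x * u^2 / 4\<close>, where \<open>u^2 / 4\<close> is a lower bound
    for \<open>cosh u\<close>. The added 1 leaves the integrable factor
    \<open>exp (- u)\<close>.\<close>
  define C where "C = exp ((\<bar>\<alpha>\<bar> + 1)\<^sup>2 / x)"
  have "(\<lambda>u::real. exp (- u)) absolutely_integrable_on {0..}"
    using integrable_on_exp_minus_to_infinity[of 1 0] by (intro nonnegative_absolutely_integrable_1) auto
  then have "set_integrable lborel {0..} (\<lambda>u::real. exp (- u))"
    unfolding set_integrable_def by (subst (asm) integrable_completion) auto
  then have dom: "set_integrable lborel {0..} (\<lambda>u::real. C * exp (- u))"
    by (rule set_integrable_mult_right)
  have bound: "exp (- x * cosh u) * cosh (\<alpha> * u) \<le> C * exp (- u)" if "u \<ge> 0" for u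
  proof -
    have "u\<^sup>2 / 4 \<le> exp u / 2"
      using exp_lower_Taylor_quadratic[OF that] that by simp
    also have "\<dots> \<le> cosh u" by (simp add: cosh_def)
    finally have "x * (u\<^sup>2 / 4) \<le> x * cosh u"
      using x by (intro mult_left_mono) auto
    moreover have "(\<bar>\<alpha>\<bar> + 1) * u - x * (u\<^sup>2 / 4) \<le> (\<bar>\<alpha>\<bar> + 1)\<^sup>2 / x"
    proof -
      have "0 \<le> (\<bar>\<alpha>\<bar> + 1 - x * u / 2)\<^sup>2" by simp
      then have "x * ((\<bar>\<alpha>\<bar> + 1) * u - x * (u\<^sup>2 / 4)) \<le> (\<bar>\<alpha>\<bar> + 1)\<^sup>2"
        by (simp add: power2_eq_square algebra_simps)
      with x show ?thesis by (simp add: field_simps)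
    qed
    ultimately have "- x * cosh u + \<bar>\<alpha>\<bar> * u \<le> (\<bar>\<alpha>\<bar> + 1)\<^sup>2 / x - u"
      by (simp add: algebra_simps)
    then have "exp (- x * cosh u) * exp (\<bar>\<alpha>\<bar> * u) \<le> C * exp (- u)"
      by (simp add: C_def flip: exp_add)
    moreover have "cosh (\<alpha> * u) \<le> exp (\<bar>\<alpha>\<bar> * u)"
    proof -
      have "\<bar>\<alpha> * u\<bar> = \<bar>\<alpha>\<bar> * u" using that by (simp add: abs_mult)
      then have "exp (\<alpha> * u) \<le> exp (\<bar>\<alpha>\<bar> * u)" "exp (- (\<alpha> * u)) \<le> exp (\<bar>\<alpha>\<bar> * u)"
        unfolding exp_le_cancel_iff by linarith+
      from add_mono[OF this] show ?thesis unfolding cosh_field_def by simp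
    qed
    ultimately show ?thesis
      by (meson exp_ge_zero mult_left_mono order_trans)
  qed
  show ?thesis
    by (rule set_integrable_bound[OF dom])
       (use bound in \<open>auto simp: set_borel_measurable_def abs_mult C_def intro!: AE_I2\<close>)
qed

text \<open>Only \<open>u\<close> in \<open>{0..1}\<close> is kept, where
  \<open>cosh u \<le> 2\<close> and \<open>cosh (\<alpha> * u) \<ge> 1\<close>. The bound is uniform
  in \<alpha>, so it serves both densities.\<close>

lemma macdonald_ge:
  assumes x: "x > 0"
  shows "macdonald \<alpha> x \<ge> exp (- (2 * x))"
proof -
  have cosh1: "cosh u \<le> 2" if "u \<in> {0..1}" for u :: real
  proof -
    have "exp u \<le> exp 1" "exp (- u) \<le> 1" using that by auto
    from add_mono[OF this] have "cosh u \<le> (exp 1 + 1) / 2"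
      unfolding cosh_field_def by (rule divide_right_mono) simp
    also have "\<dots> \<le> 2" using exp_le by simp
    finally show ?thesis .
  qed
  \<comment> \<open>The interval has length one, so the constant equals its own integral.\<close>
  have "exp (- (2 * x)) = (LINT u|lborel. indicator {0..1::real} u *\<^sub>R exp (- (2 * x)))"
    by simp
  also have "\<dots> \<le> (LINT u|lborel. indicator {0..} u *\<^sub>R (exp (- x * cosh u) * cosh (\<alpha> * u)))"
  proof (rule integral_mono)
    show "integrable lborel (\<lambda>u. indicator {0..} u *\<^sub>R (exp (- x * cosh u) * cosh (\<alpha> * u)))"
      using macdonald_integrable[OF x] unfolding set_integrable_def .
    fix u :: real
    have "exp (- (2 * x)) * 1 \<le> exp (- x * cosh u) * cosh (\<alpha> * u)" if "u \<in> {0..1}"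
    proof (intro mult_mono cosh_real_ge_1)
      show "exp (- (2 * x)) \<le> exp (- x * cosh u)"
        using cosh1[OF that] x by simp
    qed auto
    moreover have "0 \<le> exp (- x * cosh u) * cosh (\<alpha> * u)" by simp
    ultimately show "indicator {0..1::real} u *\<^sub>R exp (- (2 * x))
        \<le> indicator {0..} u *\<^sub>R (exp (- x * cosh u) * cosh (\<alpha> * u))"
      by (auto simp: indicator_def)
  qed auto
  finally show ?thesis
    by (simp add: macdonald_def set_lebesgue_integral_def)
qed

lemma macdonald_nonneg: "macdonald \<alpha> x \<ge> 0"
  unfolding macdonald_def set_lebesgue_integral_def
  by (intro Bochner_Integration.integral_nonneg) auto

text \<open>Outside the unit disc the power factor is at least 1, since \<open>2 * \<mu> + 1\<close>
  is positive; what remains is \<open>macdonald_ge\<close> at \<open>|w|^2\<close>.\<close>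

lemma dens_lower_bound:
  assumes \<mu>: "\<mu> > - 1/2"
  obtains c where "c > 0"
    "\<And>w. cmod w \<ge> 1 \<Longrightarrow> c * exp (- (2 * (cmod w)\<^sup>2)) \<le> dens_e \<mu> w"
    "\<And>w. cmod w \<ge> 1 \<Longrightarrow> c * exp (- (2 * (cmod w)\<^sup>2)) \<le> dens_o \<mu> w"
proof
  let ?c = "2 powr (1/2 - \<mu>) / (pi * Gamma (\<mu> + 1/2))"
  have "Gamma (\<mu> + 1/2) > 0" using \<mu> by (intro Gamma_real_pos) auto
  then show c: "?c > 0" by simp
  have *: "?c * exp (- (2 * (cmod w)\<^sup>2))
      \<le> ?c * macdonald \<alpha> ((cmod w)\<^sup>2) * cmod w powr (2 * \<mu> + 1)" if w: "cmod w \<ge> 1" for w \<alpha>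
  proof -
    have "1 \<le> cmod w powr (2 * \<mu> + 1)"
      using w \<mu> by (intro ge_one_powr_ge_zero) auto
    moreover have "exp (- (2 * (cmod w)\<^sup>2)) \<le> macdonald \<alpha> ((cmod w)\<^sup>2)"
      using w by (intro macdonald_ge) auto
    ultimately have "exp (- (2 * (cmod w)\<^sup>2)) * 1
        \<le> macdonald \<alpha> ((cmod w)\<^sup>2) * cmod w powr (2 * \<mu> + 1)"
      by (intro mult_mono) (auto simp: macdonald_nonneg)
    from mult_left_mono[OF this less_imp_le[OF c]] show ?thesis
      by (simp only: mult.right_neutral mult.assoc)
  qed
  show "?c * exp (- (2 * (cmod w)\<^sup>2)) \<le> dens_e \<mu> w"
       "?c * exp (- (2 * (cmod w)\<^sup>2)) \<le> dens_o \<mu> w" if "cmod w \<ge> 1" for w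
    unfolding dens_e_def dens_o_def using *[OF that] by auto
qed

section \<open>Gaussian growth of functions with finite weighted norm\<close>

text \<open>The weight \<open>D\<close> and the bound \<open>N\<close> are kept general: the lemma
  is applied with each of the two densities, both times with \<open>N\<close> the squared norm of
  the whole function.\<close>

lemma pointwise_bound:
  fixes c N :: real and D :: "complex \<Rightarrow> real"
  defines "V \<equiv> measure lborel (ball (0::complex) 1)"
  assumes c: "c > 0" and f: "f holomorphic_on UNIV" and D [measurable]: "D \<in> borel_measurable borel"
    and Dge: "\<And>w. 1 \<le> cmod w \<Longrightarrow> c * exp (- (2 * (cmod w)\<^sup>2)) \<le> D w"
    and N: "(\<integral>\<^sup>+ w. ennreal (D w) * ennreal ((cmod (f w))\<^sup>2) \<partial>lborel) \<le> ennreal N" "0 \<le> N"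
  shows "(cmod (f z))\<^sup>2 \<le> exp 20 / (c * V) * exp (4 * (cmod z)\<^sup>2) * N"
proof -
  have V: "V > 0" unfolding V_def by (rule content_ball_pos) simp
  have emV: "emeasure lborel (ball (0::complex) 1) = ennreal V"
    unfolding V_def using emeasure_lborel_ball_finite[of "0::complex" 1]
    by (intro emeasure_eq_ennreal_measure) auto
  let ?K = "exp 20 / (c * V)"
  have contf: "continuous_on UNIV f"
    using f by (rule holomorphic_on_imp_continuous_on)
  then have [measurable]: "f \<in> borel_measurable borel"
    by (rule borel_measurable_continuous_onI)
  \<comment> \<open>For \<open>|z| \<ge> 2\<close> the unit disc about \<open>z\<close> stays in the
    region where \<open>D\<close> is bounded below.\<close>
  have outer: "(cmod (f z))\<^sup>2 \<le> exp 4 / (c * V) * exp (4 * (cmod z)\<^sup>2) * N"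
    if z: "2 \<le> cmod z" for z
  proof -
    \<comment> \<open>On that disc \<open>|w|^2 \<le> (|z| + 1)^2 \<le> 2 * |z|^2 + 2\<close>, so
      \<open>D w\<close> is at least \<open>1 / L\<close>. The rate 4, and with it the factor of the
      energy, comes from here.\<close>
    define L where "L = exp (4 * (cmod z)\<^sup>2 + 4) / c"
    have L: "L > 0" using c by (simp add: L_def)
    have D1: "1 \<le> L * D w" if "w \<in> ball z 1" for w
    proof -
      have d: "cmod (z - w) < 1" using that by (simp add: dist_norm)
      have w1: "1 \<le> cmod w" using norm_triangle_ineq2[of z w] d z by linarith
      have "cmod w \<le> cmod z + 1"
        using norm_triangle_ineq2[of w z] d by (simp add: norm_minus_commute)
      then have "(cmod w)\<^sup>2 \<le> (cmod z + 1)\<^sup>2" by (intro power_mono) auto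
      also have "\<dots> \<le> 2 * (cmod z)\<^sup>2 + 2"
        using sum_power2_ge_zero[of "cmod z - 1" 0] by (simp add: power2_eq_square algebra_simps)
      finally have "1 \<le> exp (4 * (cmod z)\<^sup>2 + 4) * exp (- (2 * (cmod w)\<^sup>2))"
        by (simp flip: exp_add)
      also have "\<dots> = L * (c * exp (- (2 * (cmod w)\<^sup>2)))"
        using c by (simp add: L_def)
      also have "\<dots> \<le> L * D w"
        using Dge[OF w1] L by (intro mult_left_mono) auto
      finally show ?thesis .
    qed
    \<comment> \<open>The mean value inequality is used for the square of \<open>f\<close>, whose
      modulus is the integrand of the squared norm.\<close>
    have "(\<lambda>w. (f w)\<^sup>2) holomorphic_on UNIV"
      using f by (intro holomorphic_intros)
    from ball_submean[OF this, of z]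
    have "ennreal ((cmod (f z))\<^sup>2 * V)
        \<le> (\<integral>\<^sup>+ w. indicator (ball z 1) w * ennreal ((cmod (f w))\<^sup>2) \<partial>lborel)"
      using V by (simp add: emV norm_power ennreal_mult)
    also have "\<dots> \<le> (\<integral>\<^sup>+ w. ennreal L * (ennreal (D w) * ennreal ((cmod (f w))\<^sup>2)) \<partial>lborel)"
    proof (rule nn_integral_mono)
      fix w
      show "indicator (ball z 1) w * ennreal ((cmod (f w))\<^sup>2)
          \<le> ennreal L * (ennreal (D w) * ennreal ((cmod (f w))\<^sup>2))"
      proof (cases "w \<in> ball z 1")
        case True
        have "1 \<le> ennreal (L * D w)" using D1[OF True] by simp
        then have "1 \<le> ennreal L * ennreal (D w)"
          using L D1[OF True] by (simp add: ennreal_mult')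
        then have "1 * ennreal ((cmod (f w))\<^sup>2)
            \<le> ennreal L * ennreal (D w) * ennreal ((cmod (f w))\<^sup>2)"
          by (intro mult_right_mono) auto
        with True show ?thesis by (simp add: mult.assoc)
      qed simp
    qed
    also have "\<dots> = ennreal L * (\<integral>\<^sup>+ w. ennreal (D w) * ennreal ((cmod (f w))\<^sup>2) \<partial>lborel)"
      by (rule nn_integral_cmult) measurable
    also have "\<dots> \<le> ennreal L * ennreal N"
      by (intro mult_left_mono N) auto
    also have "\<dots> = ennreal (L * N)"
      using L N by (simp add: ennreal_mult)
    finally have "(cmod (f z))\<^sup>2 * V \<le> L * N"
      using L N by simp
    then show ?thesis
      using V c by (simp add: L_def field_simps exp_add)
  qed
  show "(cmod (f z))\<^sup>2 \<le> ?K * exp (4 * (cmod z)\<^sup>2) * N"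
  proof (cases "2 \<le> cmod z")
    case True
    have "exp 4 / (c * V) * exp (4 * (cmod z)\<^sup>2) * N \<le> ?K * exp (4 * (cmod z)\<^sup>2) * N"
      using c V N by (intro mult_right_mono divide_right_mono) auto
    with outer[OF True] show ?thesis by linarith
  next
    case False
    \<comment> \<open>On the circle \<open>|w| = 2\<close> the bound \<open>outer\<close> has the
      factor \<open>exp 4 * exp 16\<close>, hence the constant \<open>exp 20\<close>.\<close>
    have "cmod (f z) \<le> sqrt (?K * N)"
    proof (rule maximum_modulus_frontier[of f "ball 0 2"])
      show "continuous_on (closure (ball 0 2)) f"
        using contf continuous_on_subset by blast
      show "z \<in> ball 0 2" using False by simp
      fix w :: complex
      assume "w \<in> frontier (ball 0 2)"
      then have w: "cmod w = 2" by simp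
      have "(cmod (f w))\<^sup>2 \<le> ?K * N"
        using outer[of w] w by (simp add: exp_add[symmetric])
      then show "cmod (f w) \<le> sqrt (?K * N)" by (rule real_le_rsqrt)
    qed (use f holomorphic_on_subset in auto)
    then have "(cmod (f z))\<^sup>2 \<le> (sqrt (?K * N))\<^sup>2" by (intro power_mono) auto
    also have "\<dots> = ?K * 1 * N" using c V N by simp
    also have "\<dots> \<le> ?K * exp (4 * (cmod z)\<^sup>2) * N"
      using c V N by (intro mult_right_mono mult_left_mono) auto
    finally show ?thesis .
  qed
qed

section \<open>Integration over the two sheets and entropy estimates\<close>

lemma measurable_nu:
  assumes [measurable]: "(\<lambda>z. F (z, 1)) \<in> borel_measurable borel"
    "(\<lambda>z. F (z, -1)) \<in> borel_measurable borel"
  shows "F \<in> borel_measurable (nu \<mu>)"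
proof -
  \<comment> \<open>This function agrees with \<open>F\<close> on the space of the product, where
    the second coordinate is 1 or -1.\<close>
  have "(\<lambda>p. if snd p = 1 then F (fst p, 1) else F (fst p, -1))
      \<in> borel_measurable (lborel \<Otimes>\<^sub>M count_space {-1, 1::int})"
    by measurable
  also have "?this \<longleftrightarrow> F \<in> borel_measurable (lborel \<Otimes>\<^sub>M count_space {-1, 1::int})"
    by (intro measurable_cong) (auto simp: space_pair_measure)
  finally show ?thesis
    by (simp add: nu_def)
qed

lemma nn_integral_nu:
  fixes F :: "complex \<times> int \<Rightarrow> ennreal"
  assumes F [measurable]: "(\<lambda>z. F (z, 1)) \<in> borel_measurable borel"
    "(\<lambda>z. F (z, -1)) \<in> borel_measurable borel"
  shows "(\<integral>\<^sup>+ p. F p \<partial>nu \<mu>) = (\<integral>\<^sup>+ z. F (z, 1) \<partial>nu_e \<mu>) + (\<integral>\<^sup>+ z. F (z, -1) \<partial>nu_o \<mu>)"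
proof -
  interpret C: sigma_finite_measure "count_space {-1, 1::int}"
    by (rule sigma_finite_measure_count_space_finite) simp
  let ?P = "lborel \<Otimes>\<^sub>M count_space {-1, 1::int}"
  have [measurable]: "F \<in> borel_measurable ?P"
    using measurable_nu[OF F] by (simp add: nu_def)
  define d where "d = (\<lambda>(z, s::int). ennreal (if s = 1 then dens_e \<mu> z else dens_o \<mu> z))"
  have [measurable]: "d \<in> borel_measurable ?P"
    unfolding d_def by measurable
  have "(\<integral>\<^sup>+ p. F p \<partial>nu \<mu>) = (\<integral>\<^sup>+ p. d p * F p \<partial>?P)"
    unfolding nu_def d_def[symmetric] by (rule nn_integral_density) measurable
  also have "\<dots> = (\<integral>\<^sup>+ z. \<integral>\<^sup>+ s. d (z, s) * F (z, s) \<partial>count_space {-1, 1} \<partial>lborel)"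
    by (rule C.nn_integral_fst[symmetric]) measurable
  also have "\<dots> = (\<integral>\<^sup>+ z. ennreal (dens_e \<mu> z) * F (z, 1) + ennreal (dens_o \<mu> z) * F (z, -1) \<partial>lborel)"
    by (intro nn_integral_cong) (simp add: nn_integral_count_space_finite d_def add.commute)
  also have "\<dots> = (\<integral>\<^sup>+ z. F (z, 1) \<partial>nu_e \<mu>) + (\<integral>\<^sup>+ z. F (z, -1) \<partial>nu_o \<mu>)"
    by (simp add: nn_integral_add nu_e_def nu_o_def nn_integral_density)
  finally show ?thesis .
qed

text \<open>The positive part of \<open>k\<close> is dominated by \<open>|g|\<close>, so its
  integral is finite. If the negative part has infinite integral, the left side is minus infinity;
  otherwise \<open>k\<close> is integrable and monotonicity applies.\<close>

lemma ext_integral_le_integral: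
  assumes [measurable]: "k \<in> borel_measurable M" and g: "integrable M g"
    and le: "\<And>x. x \<in> space M \<Longrightarrow> k x \<le> g x"
  shows "ext_integral M k \<le> ereal (LINT x|M. g x)"
proof -
  have "(\<integral>\<^sup>+ x. ennreal (k x) \<partial>M) \<le> (\<integral>\<^sup>+ x. ennreal (norm (g x)) \<partial>M)"
    using le by (intro nn_integral_mono ennreal_leI) force
  also have "\<dots> < \<infinity>" using g by (simp add: integrable_iff_bounded)
  finally have pos: "(\<integral>\<^sup>+ x. ennreal (k x) \<partial>M) \<noteq> \<infinity>" by simp
  show ?thesis
  proof (cases "(\<integral>\<^sup>+ x. ennreal (- k x) \<partial>M) = \<infinity>")
    case True
    with pos show ?thesis
      by (cases "\<integral>\<^sup>+ x. ennreal (k x) \<partial>M") (auto simp: ext_integral_def)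
  next
    case False
    have k: "integrable M k"
      using pos False by (auto simp: real_integrable_def)
    have "ext_integral M k = ereal (LINT x|M. k x)"
      using pos False
      by (cases "\<integral>\<^sup>+ x. ennreal (k x) \<partial>M"; cases "\<integral>\<^sup>+ x. ennreal (- k x) \<partial>M")
         (auto simp: ext_integral_def real_lebesgue_integral_def[OF k])
    also have "\<dots> \<le> ereal (LINT x|M. g x)"
      using integral_mono[OF k g le] by simp
    finally show ?thesis .
  qed
qed

text \<open>Where \<open>h\<close> vanishes both sides are 0; where \<open>h > 0\<close> the upper
  bound forces \<open>N > 0\<close>, so the logarithm of the product splits.\<close>

lemma mult_ln_le:
  fixes h K N :: real
  assumes "0 \<le> h" "h \<le> K * exp y * N" "0 < K" "0 \<le> N"
  shows "h * ln h \<le> h * (ln K + y + ln N)"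
proof (cases "h = 0")
  case False
  with assms have h: "0 < h" by simp
  with assms have "N \<noteq> 0" by auto
  with assms have "0 < N" by simp
  with assms h have "ln h \<le> ln (K * exp y * N)" by simp
  also have "\<dots> = ln K + y + ln N" using assms \<open>0 < N\<close> by (simp add: ln_mult)
  finally show ?thesis using h by (intro mult_left_mono) auto
qed simp

section \<open>The entropy-energy inequality\<close>

theorem theorem4p7:
  fixes \<mu> :: real
  assumes "\<mu> > - 1/2"
  shows "\<exists>a b c :: real. a > 0 \<and> b > 0 \<and> c \<ge> 0 \<and>
    (\<forall>f \<in> B2 \<mu>.
       ereal a * entropy_mu \<mu> f
         \<le> ereal b * enn2ereal (energy_mu \<mu> f) + ereal (c * (norm_B2 \<mu> f)\<^sup>2))"
proof -
  obtain c where c: "c > 0"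
    "\<And>w. cmod w \<ge> 1 \<Longrightarrow> c * exp (- (2 * (cmod w)\<^sup>2)) \<le> dens_e \<mu> w"
    "\<And>w. cmod w \<ge> 1 \<Longrightarrow> c * exp (- (2 * (cmod w)\<^sup>2)) \<le> dens_o \<mu> w"
    using dens_lower_bound[OF assms] by blast
  define K where "K = exp 20 / (c * measure lborel (ball (0::complex) 1))"
  have K: "K > 0"
    using c(1) content_ball_pos[of 1 "0::complex"] by (simp add: K_def)
  note pw = pointwise_bound[OF c(1), folded K_def]
  have "ereal 1 * entropy_mu \<mu> f
      \<le> ereal 4 * enn2ereal (energy_mu \<mu> f) + ereal (\<bar>ln K\<bar> * (norm_B2 \<mu> f)\<^sup>2)"
    if f: "f \<in> B2 \<mu>" for f
  proof (cases "energy_mu \<mu> f = \<infinity>")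
    \<comment> \<open>Infinite energy makes the right side infinite. In the other case finite energy
      makes \<open>q\<close> integrable.\<close>
    case True
    then show ?thesis by simp
  next
    case False
    have holf: "f holomorphic_on UNIV" using f by (simp add: B2_def)
    then have "(\<lambda>z. f (- z)) holomorphic_on UNIV"
      by (intro holomorphic_on_compose[of uminus UNIV f, unfolded o_def] holomorphic_intros)
         (auto intro: holomorphic_on_subset)
    with holf have hol: "even_part f holomorphic_on UNIV" "odd_part f holomorphic_on UNIV"
      unfolding even_part_def odd_part_def by (auto intro!: holomorphic_intros)
    have meas [measurable]: "even_part f \<in> borel_measurable borel" "odd_part f \<in> borel_measurable borel"
      using hol by (auto intro!: borel_measurable_continuous_onI holomorphic_on_imp_continuous_on)
    have L2: "integrable (nu_e \<mu>) (\<lambda>z. (cmod (even_part f z))\<^sup>2)"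
      "integrable (nu_o \<mu>) (\<lambda>z. (cmod (odd_part f z))\<^sup>2)"
      using f by (auto simp: B2_def in_L2_def)
    define Ne No where "Ne = (LINT z|nu_e \<mu>. (cmod (even_part f z))\<^sup>2)"
      and "No = (LINT z|nu_o \<mu>. (cmod (odd_part f z))\<^sup>2)"
    have N0: "Ne \<ge> 0" "No \<ge> 0" by (simp_all add: Ne_def No_def)
    \<comment> \<open>Both parts are bounded with the total \<open>N\<close>, because the entropy on
      the two sheets is normalised by \<open>N * ln N\<close>.\<close>
    define N where "N = Ne + No"
    have N: "N \<ge> 0" "(norm_B2 \<mu> f)\<^sup>2 = N"
      using N0 by (simp_all add: N_def norm_B2_def norm_L2_def Ne_def No_def)
    have nn: "(\<integral>\<^sup>+ z. ennreal ((cmod (even_part f z))\<^sup>2) \<partial>nu_e \<mu>) = ennreal Ne"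
       "(\<integral>\<^sup>+ z. ennreal ((cmod (odd_part f z))\<^sup>2) \<partial>nu_o \<mu>) = ennreal No"
      unfolding Ne_def No_def by (intro nn_integral_eq_integral L2; simp)+
    have pw_e: "(cmod (even_part f z))\<^sup>2 \<le> K * exp (4 * (cmod z)\<^sup>2) * N" for z
    proof (rule pw[of _ "dens_e \<mu>"])
      show "(\<integral>\<^sup>+ w. ennreal (dens_e \<mu> w) * ennreal ((cmod (even_part f w))\<^sup>2) \<partial>lborel) \<le> ennreal N"
        using nn(1) N0 by (simp add: nu_e_def nn_integral_density N_def ennreal_leI)
    qed (use hol c N in auto)
    have pw_o: "(cmod (odd_part f z))\<^sup>2 \<le> K * exp (4 * (cmod z)\<^sup>2) * N" for z
    proof (rule pw[of _ "dens_o \<mu>"])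
      show "(\<integral>\<^sup>+ w. ennreal (dens_o \<mu> w) * ennreal ((cmod (odd_part f w))\<^sup>2) \<partial>lborel) \<le> ennreal N"
        using nn(2) N0 by (simp add: nu_o_def nn_integral_density N_def ennreal_leI)
    qed (use hol c N in auto)
    define F where "F = (\<lambda>(z, s::int). if s = 1 then even_part f z else odd_part f z)"
    define h where "h p = (cmod (F p))\<^sup>2" for p
    define q where "q p = (cmod (fst p))\<^sup>2 * h p" for p :: "complex \<times> int"
    have h0: "h p \<ge> 0" for p by (simp add: h_def)
    have [measurable]: "F \<in> borel_measurable (nu \<mu>)"
      by (rule measurable_nu) (auto simp: F_def)
    have [measurable]: "h \<in> borel_measurable (nu \<mu>)"
      unfolding h_def by measurable
    have [measurable]: "q \<in> borel_measurable (nu \<mu>)"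
      by (rule measurable_nu) (auto simp: q_def h_def F_def)
    have nh: "(\<integral>\<^sup>+ p. ennreal (h p) \<partial>nu \<mu>) = ennreal N"
      using N0 by (subst nn_integral_nu) (auto simp: h_def F_def nn N_def)
    have inth: "integrable (nu \<mu>) h"
      by (rule integrableI_nonneg) (auto simp: h0 nh)
    have Ih: "(LINT p|nu \<mu>. h p) = N"
      by (rule integral_eq_nn_integral[THEN trans]) (auto simp: h0 nh N)
    have nq: "(\<integral>\<^sup>+ p. ennreal (q p) \<partial>nu \<mu>) = energy_mu \<mu> f"
      by (subst nn_integral_nu) (auto simp: q_def h_def F_def energy_mu_def)
    have q0: "q p \<ge> 0" for p by (simp add: q_def h0)
    have intq: "integrable (nu \<mu>) q"
      using False by (intro integrableI_nonneg) (auto simp: q0 nq less_top)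
    have Iq: "energy_mu \<mu> f = ennreal (LINT p|nu \<mu>. q p)"
      using nn_integral_eq_integral[OF intq] by (simp add: q0 nq)
    \<comment> \<open>This is the right side of \<open>mult_ln_le\<close> with
      \<open>y = 4 * |z|^2\<close>, an integrable majorant of \<open>h * ln h\<close>.\<close>
    define g where "g p = 4 * q p + (ln K + ln N) * h p" for p
    have "h p * ln (h p) \<le> g p" for p
    proof -
      have "h p \<le> K * exp (4 * (cmod (fst p))\<^sup>2) * N"
        using pw_e pw_o by (simp add: h_def F_def case_prod_beta)
      from mult_ln_le[OF h0 this K N(1)] show ?thesis
        by (simp add: g_def q_def algebra_simps)
    qed
    moreover have intg: "integrable (nu \<mu>) g"
      unfolding g_def using inth intq by auto
    ultimately have "ext_integral (nu \<mu>) (\<lambda>p. h p * ln (h p)) \<le> ereal (LINT p|nu \<mu>. g p)"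
      by (intro ext_integral_le_integral) auto
    also have "(LINT p|nu \<mu>. g p) = 4 * (LINT p|nu \<mu>. q p) + (ln K + ln N) * N"
      unfolding g_def using inth intq by (simp add: Ih)
    finally have ext: "ext_integral (nu \<mu>) (\<lambda>p. h p * ln (h p))
        \<le> ereal (4 * (LINT p|nu \<mu>. q p) + (ln K + ln N) * N)" .
    have "(norm_L2 (nu \<mu>) F)\<^sup>2 = N"
      using N Ih by (simp add: norm_L2_def h_def)
    then have "entropy_mu \<mu> f = ext_integral (nu \<mu>) (\<lambda>p. h p * ln (h p)) - ereal (N * ln N)"
      by (simp add: entropy_mu_def entropy_L2_def F_def[symmetric] h_def)
    also have "\<dots> \<le> ereal (4 * (LINT p|nu \<mu>. q p) + (ln K + ln N) * N) - ereal (N * ln N)"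
      using ext by (intro ereal_minus_mono) auto
    \<comment> \<open>The normalising term cancels \<open>ln N * N\<close>, which makes the estimate
      homogeneous in \<open>f\<close>.\<close>
    also have "\<dots> = ereal (4 * (LINT p|nu \<mu>. q p) + ln K * N)"
      by (simp add: algebra_simps)
    \<comment> \<open>\<open>ln K\<close> may be negative, while the constant must be
      nonnegative.\<close>
    also have "\<dots> \<le> ereal (4 * (LINT p|nu \<mu>. q p) + \<bar>ln K\<bar> * N)"
      using N by (auto intro!: mult_right_mono)
    also have "\<dots> = ereal 4 * enn2ereal (energy_mu \<mu> f) + ereal (\<bar>ln K\<bar> * (norm_B2 \<mu> f)\<^sup>2)"
      by (simp add: Iq N q0)
    finally show ?thesis by simp
  qed
  then show ?thesis
    by (intro exI[of _ 1] exI[of _ 4] exI[of _ "\<bar>ln K\<bar>"]) auto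
qed

end
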